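(* Let $p$ and $q$ be integers with $p > 2$ and $0 < q \le p+1$. If the diophantine equation $$x^2 - pxy + y^2 = q$$ has a solution $(x,y) \in \mathbb{Z}^2$, then $q$ is a perfect square. *)

theory Defs
  imports "HOL-Computational_Algebra.Nth_Powers"
begin

end

theory Submission
  imports Defs
begin

text \<open>
  The proof is a descent by Vieta jumping. For fixed \<open>y\<close> the equation is a monic quadratic in
  \<open>x\<close>, so a root \<open>x\<close> has the companion root \<open>p * y - x\<close>, and the product of the two roots is
  \<open>y\<^sup>2 - q\<close>. The bound \<open>q \<le> p + 1\<close> enters through one observation: the coordinates of a solution
  can never have strictly opposite signs, because then the left-hand side is at least \<open>p + 2\<close>
  (lemma \<open>solution_same_sign\<close>). Hence jumping from a solution in positive integers leaves the
  companion root nonnegative. When \<open>y \<le> x\<close>, the product formula makes the companion root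
  smaller than \<open>y\<close>, so the coordinate sum drops. The descent therefore ends
  at a solution with a zero coordinate, where the equation exhibits \<open>q\<close> as the square of the
  other coordinate (lemma \<open>nonneg_solution_imp_square\<close>).
\<close>

text \<open>
  For coordinates of opposite signs the positive integers \<open>x\<^sup>2\<close>, \<open>y\<^sup>2\<close> and \<open>- x * y\<close> are each
  at least \<open>1\<close>, so the form has no cancellation and its value is at least \<open>1 + p + 1\<close>.
\<close>

lemma solution_same_sign:
  fixes p q x y :: int
  assumes "p \<ge> 0" and "q \<le> p + 1" and eq: "x\<^sup>2 - p * x * y + y\<^sup>2 = q"
  shows "x * y \<ge> 0"
proof (rule ccontr)
  assume "\<not> x * y \<ge> 0"
  then have neg: "x * y \<le> - 1" and "x \<noteq> 0" "y \<noteq> 0" by auto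
  then have "x\<^sup>2 > 0" "y\<^sup>2 > 0" by simp_all
  moreover have "p * (x * y) \<le> p * (- 1)"
    using neg \<open>p \<ge> 0\<close> by (rule mult_left_mono)
  ultimately show False using eq \<open>q \<le> p + 1\<close> unfolding mult.assoc by linarith
qed

lemma nonneg_solution_imp_square:
  fixes p q x y :: int
  assumes "p \<ge> 0" and "0 < q" and "q \<le> p + 1"
    and "x \<ge> 0" and "y \<ge> 0" and "x\<^sup>2 - p * x * y + y\<^sup>2 = q"
  shows "is_square q"
  using assms(4-6)
proof (induction "nat (x + y)" arbitrary: x y rule: less_induct)
  case less
  \<comment> \<open>The descent step needs ordered coordinates; as the equation is symmetric, it serves both orders.\<close>
  have ordered: "is_square q"
    if "b \<le> a" "b \<ge> 0" and sum: "a + b = x + y" and eq: "a\<^sup>2 - p * a * b + b\<^sup>2 = q" for a b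
  proof (cases "b = 0")
    case True
    with eq show ?thesis by auto
  next
    case False
    with \<open>b \<ge> 0\<close> \<open>b \<le> a\<close> have "b > 0" "a > 0" by simp_all
    define c where "c = p * b - a"
    have eq_c: "c\<^sup>2 - p * c * b + b\<^sup>2 = q"
      using eq unfolding c_def by (simp add: power2_eq_square algebra_simps)
    have prod: "a * c = b\<^sup>2 - q"
      using eq unfolding c_def by (simp add: power2_eq_square algebra_simps)
    have "c * b \<ge> 0" using solution_same_sign[OF assms(1,3) eq_c] .
    with \<open>b > 0\<close> have "c \<ge> 0" by (simp add: zero_le_mult_iff)
    have "a * c < b * b" using prod \<open>0 < q\<close> by (simp add: power2_eq_square)
    also have "\<dots> \<le> a * b" using \<open>b \<le> a\<close> \<open>b \<ge> 0\<close> by (rule mult_right_mono)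
    finally have "c < b" using \<open>a > 0\<close> by simp
    with \<open>b \<le> a\<close> sum \<open>b > 0\<close> have "nat (c + b) < nat (x + y)" by simp
    then show ?thesis using less.hyps \<open>c \<ge> 0\<close> \<open>b \<ge> 0\<close> eq_c by blast
  qed
  show ?case
  proof (cases "y \<le> x")
    case True
    then show ?thesis using ordered[of y x] less.prems by simp
  next
    case False
    then show ?thesis using ordered[of x y] less.prems by (simp add: algebra_simps)
  qed
qed

theorem theorem6:
  fixes p q :: int
  assumes "p > 2" and "0 < q" and "q \<le> p + 1"
    and "\<exists>x y :: int. x^2 - p * x * y + y^2 = q"
  shows "is_square q"
proof -
  obtain x y :: int where eq: "x\<^sup>2 - p * x * y + y\<^sup>2 = q" using assms(4) by blast
  have "p \<ge> 0" using \<open>p > 2\<close> by simp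
  have "x * y \<ge> 0" using solution_same_sign[OF \<open>p \<ge> 0\<close> assms(3) eq] .
  \<comment> \<open>The form takes the same value at the negated point, so a solution may be reflected into the nonnegative quadrant.\<close>
  then have "\<bar>x\<bar> * \<bar>y\<bar> = x * y" by (simp flip: abs_mult)
  then have "\<bar>x\<bar>\<^sup>2 - p * \<bar>x\<bar> * \<bar>y\<bar> + \<bar>y\<bar>\<^sup>2 = q" using eq by (simp add: mult.assoc)
  then show ?thesis
    using nonneg_solution_imp_square[OF \<open>p \<ge> 0\<close> assms(2,3), of "\<bar>x\<bar>" "\<bar>y\<bar>"] by simp
qed

end
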